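(* A clean $C^{2}$ immersed loop $\alpha\colon\mathbf{S}^1\to\mathbf{R}^2$ with even, non-zero rotation index cannot have central symmetry.
   Context: An immersed loop $\alpha$ has central symmetry if for some $\mathbf{c}\in\mathbf{R}^2$ its image is mapped to itself by $x\mapsto 2\mathbf{c}-x$. It is clean if, whenever $t_1\neq t_2$ in $\mathbf{S}^1$ are preimages of a single point, they have respective neighborhoods $U_1,U_2$ whose images $\alpha(U_1),\alpha(U_2)$ intersect transversally. The rotation index of $\alpha$ is the degree of its unit tangent map $\alpha'/|\alpha'|\colon\mathbf{S}^1\to\mathbf{S}^1$. *)

theory Defs
  imports "HOL-Analysis.Analysis"
begin

text \<open>
  The plane \<open>R\<^sup>2\<close> is \<^typ>\<open>complex\<close> with its real vector space structure, and
  \<open>S\<^sup>1\<close> is its unit circle.  A map on \<open>S\<^sup>1\<close> is a total function of which only the values on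
  the circle matter.
\<close>

abbreviation S1 :: "complex set" where
  "S1 \<equiv> sphere 0 1"


subsection \<open>Immersed loops\<close>

text \<open>
  The derivative with respect to the angle.  Since \<open>cis t * cis s = cis (t + s)\<close>,
  at \<open>z = cis t\<close> this is the derivative of \<open>\<alpha> \<circ> cis\<close> at \<open>t\<close>.
\<close>

definition circle_deriv :: "(complex \<Rightarrow> complex) \<Rightarrow> complex \<Rightarrow> complex" where
  "circle_deriv \<alpha> z = vector_derivative (\<lambda>s. \<alpha> (z * cis s)) (at 0)"

lemma circle_deriv_cis:
  "circle_deriv \<alpha> (cis t) = vector_derivative (\<lambda>s. \<alpha> (cis s)) (at t)"
proof -
  have "((\<lambda>s. \<alpha> (cis t * cis s)) has_vector_derivative D) (at 0) \<longleftrightarrow>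
        ((\<lambda>s. \<alpha> (cis s)) has_vector_derivative D) (at t)" for D
  proof
    assume "((\<lambda>s. \<alpha> (cis t * cis s)) has_vector_derivative D) (at 0)"
    then have "((\<lambda>s. \<alpha> (cis t * cis s)) has_vector_derivative D) (at (t - t))"
      by simp
    moreover have "((\<lambda>s. s - t) has_vector_derivative 1) (at t)"
      by (auto intro!: derivative_eq_intros)
    ultimately have "(((\<lambda>s. \<alpha> (cis t * cis s)) \<circ> (\<lambda>s. s - t)) has_vector_derivative (1 *\<^sub>R D)) (at t)"
      by (intro vector_diff_chain_at)
    then show "((\<lambda>s. \<alpha> (cis s)) has_vector_derivative D) (at t)"
      by (simp add: o_def cis_mult)
  next
    assume "((\<lambda>s. \<alpha> (cis s)) has_vector_derivative D) (at t)"
    then have "((\<lambda>s. \<alpha> (cis s)) has_vector_derivative D) (at (t + 0))"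
      by simp
    moreover have "((\<lambda>s. t + s) has_vector_derivative 1) (at 0)"
      by (auto intro!: derivative_eq_intros)
    ultimately have "(((\<lambda>s. \<alpha> (cis s)) \<circ> (\<lambda>s. t + s)) has_vector_derivative (1 *\<^sub>R D)) (at 0)"
      by (intro vector_diff_chain_at)
    then show "((\<lambda>s. \<alpha> (cis t * cis s)) has_vector_derivative D) (at 0)"
      by (simp add: o_def cis_mult)
  qed
  then show ?thesis
    by (simp add: circle_deriv_def vector_derivative_def)
qed

definition C2_on_circle :: "(complex \<Rightarrow> complex) \<Rightarrow> bool" where
  "C2_on_circle \<alpha> \<longleftrightarrow>
     (\<lambda>t. \<alpha> (cis t)) C1_differentiable_on UNIV \<and>
     (\<lambda>t. circle_deriv \<alpha> (cis t)) C1_differentiable_on UNIV"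

definition C2_immersed_loop :: "(complex \<Rightarrow> complex) \<Rightarrow> bool" where
  "C2_immersed_loop \<alpha> \<longleftrightarrow> C2_on_circle \<alpha> \<and> (\<forall>z\<in>S1. circle_deriv \<alpha> z \<noteq> 0)"

definition centrally_symmetric :: "(complex \<Rightarrow> complex) \<Rightarrow> bool" where
  "centrally_symmetric \<alpha> \<longleftrightarrow> (\<exists>c. (\<lambda>x. 2 * c - x) ` (\<alpha> ` S1) = \<alpha> ` S1)"

text \<open>
  Transversality of the pieces \<open>\<alpha> ` U\<close> and \<open>\<alpha> ` V\<close> of an immersed loop: wherever they meet,
  their tangent lines together span the plane (\<^const>\<open>span\<close> is the real span).
\<close>

definition transversal_images :: "(complex \<Rightarrow> complex) \<Rightarrow> complex set \<Rightarrow> complex set \<Rightarrow> bool" where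
  "transversal_images \<alpha> U V \<longleftrightarrow>
     (\<forall>u\<in>U. \<forall>v\<in>V. \<alpha> u = \<alpha> v \<longrightarrow> span {circle_deriv \<alpha> u, circle_deriv \<alpha> v} = UNIV)"

definition clean :: "(complex \<Rightarrow> complex) \<Rightarrow> bool" where
  "clean \<alpha> \<longleftrightarrow>
     (\<forall>z\<in>S1. \<forall>w\<in>S1. z \<noteq> w \<and> \<alpha> z = \<alpha> w \<longrightarrow>
        (\<exists>U V. openin (top_of_set S1) U \<and> z \<in> U \<and>
               openin (top_of_set S1) V \<and> w \<in> V \<and>
               transversal_images \<alpha> U V))"


subsection \<open>Degree and rotation index\<close>

text \<open>
  \<open>circle_lift f \<theta> n\<close>: the continuous function \<open>\<theta>\<close> is an angle function for the circle map \<open>f\<close>,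
  and it increases by \<open>n\<close> full turns over one period.
\<close>

definition circle_lift :: "(complex \<Rightarrow> complex) \<Rightarrow> (real \<Rightarrow> real) \<Rightarrow> int \<Rightarrow> bool" where
  "circle_lift f \<theta> n \<longleftrightarrow>
     continuous_on UNIV \<theta> \<and>
     (\<forall>t. f (cis t) = cis (\<theta> t)) \<and>
     (\<forall>t. \<theta> (t + 2 * pi) = \<theta> t + 2 * pi * of_int n)"

definition circle_degree :: "(complex \<Rightarrow> complex) \<Rightarrow> int" where
  "circle_degree f = (THE n. \<exists>\<theta>. circle_lift f \<theta> n)"

definition unit_tangent :: "(complex \<Rightarrow> complex) \<Rightarrow> complex \<Rightarrow> complex" where
  "unit_tangent \<alpha> z = circle_deriv \<alpha> z /\<^sub>R norm (circle_deriv \<alpha> z)"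

definition rotation_index :: "(complex \<Rightarrow> complex) \<Rightarrow> int" where
  "rotation_index \<alpha> = circle_degree (unit_tangent \<alpha>)"


text \<open>Every continuous map from the circle to itself has a well-defined degree.\<close>

lemma cis_eq_constant_diff:
  fixes \<theta> \<phi> :: "real \<Rightarrow> real"
  assumes "continuous_on UNIV \<theta>" "continuous_on UNIV \<phi>" and eq: "\<And>t. cis (\<theta> t) = cis (\<phi> t)"
  obtains k :: int where "\<And>t. \<theta> t = \<phi> t + 2 * pi * of_int k"
proof -
  define d where "d t = (\<theta> t - \<phi> t) / (2 * pi)" for t
  have int: "\<exists>k::int. d t = of_int k" for t
  proof -
    have "sin (\<theta> t) = sin (\<phi> t) \<and> cos (\<theta> t) = cos (\<phi> t)"
      using eq[of t] by (simp add: cis.ctr)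
    then obtain k :: int where "\<theta> t = \<phi> t + 2 * pi * of_int k"
      using sin_cos_eq_iff[of "\<theta> t" "\<phi> t"] by auto
    then show ?thesis by (auto simp: d_def)
  qed
  have "d constant_on UNIV"
  proof (rule continuous_discrete_range_constant)
    show "continuous_on UNIV d"
      unfolding d_def by (intro continuous_intros assms) auto
    fix x :: real
    show "\<exists>e>0. \<forall>y. y \<in> UNIV \<and> d y \<noteq> d x \<longrightarrow> e \<le> norm (d y - d x)"
    proof (intro exI[of _ 1] conjI allI impI)
      fix y assume "y \<in> UNIV \<and> d y \<noteq> d x"
      moreover obtain j k :: int where "d y = of_int j" "d x = of_int k"
        using int by metis
      ultimately have "j \<noteq> k" and *: "norm (d y - d x) = of_int \<bar>j - k\<bar>"
        by auto
      from \<open>j \<noteq> k\<close> have "1 \<le> \<bar>j - k\<bar>" by simp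
      then show "1 \<le> norm (d y - d x)" unfolding * by linarith
    qed simp
  qed simp
  then obtain c where c: "\<And>t. d t = c" by (auto simp: constant_on_def)
  obtain k :: int where "c = of_int k" using int[of 0] c by auto
  then have "\<theta> t = \<phi> t + 2 * pi * of_int k" for t
    using c[of t] by (simp add: d_def field_simps)
  then show thesis by (rule that)
qed

lemma circle_lift_unique:
  assumes "circle_lift f \<theta> m" "circle_lift f \<phi> n"
  shows "m = n"
proof -
  obtain k :: int where k: "\<And>t. \<theta> t = \<phi> t + 2 * pi * of_int k"
    using cis_eq_constant_diff[of \<theta> \<phi>] assms unfolding circle_lift_def by metis
  have "2 * pi * of_int m = \<theta> (0 + 2 * pi) - \<theta> 0"
    using assms(1) unfolding circle_lift_def by (simp del: add_0)
  also have "\<dots> = \<phi> (0 + 2 * pi) - \<phi> 0"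
    unfolding k by simp
  also have "\<dots> = 2 * pi * of_int n"
    using assms(2) unfolding circle_lift_def by (simp del: add_0)
  finally show ?thesis by simp
qed

lemma circle_degree_eqI:
  assumes "circle_lift f \<theta> n"
  shows "circle_degree f = n"
  unfolding circle_degree_def using assms circle_lift_unique by blast

lemma circle_lift_exists:
  assumes cont: "continuous_on UNIV (\<lambda>t. f (cis t))" and S1: "f ` S1 \<subseteq> S1"
  shows "\<exists>\<theta> n. circle_lift f \<theta> n"
proof -
  have norm1: "norm (f (cis t)) = 1" for t
    using S1 by (auto simp: image_subset_iff)
  then have nz: "f (cis t) \<noteq> 0" for t
    by (metis norm_zero zero_neq_one)
  obtain g where g: "continuous_on UNIV g" "\<And>t::real. f (cis t) = exp (g t)"
    using continuous_logarithm_on_contractible[OF cont] nz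
    by (metis UNIV_I contractible_UNIV)
  define \<theta> where "\<theta> t = Im (g t)" for t
  have Re0: "Re (g t) = 0" for t
    using norm1[of t] by (simp add: g(2))
  have lift: "f (cis t) = cis (\<theta> t)" for t
    by (simp add: g(2) exp_eq_polar Re0 \<theta>_def)
  have cont\<theta>: "continuous_on UNIV \<theta>"
    unfolding \<theta>_def by (intro continuous_intros g)
  have "continuous_on UNIV (\<lambda>t. \<theta> (t + 2 * pi))"
    by (rule continuous_on_compose2[OF cont\<theta>]) (auto intro!: continuous_intros)
  moreover have "cis (\<theta> (t + 2 * pi)) = cis (\<theta> t)" for t
  proof -
    have "cis (t + 2 * pi) = cis t" by (simp add: cis.ctr)
    then show ?thesis using lift by metis
  qed
  ultimately obtain k :: int where "\<And>t. \<theta> (t + 2 * pi) = \<theta> t + 2 * pi * of_int k"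
    using cis_eq_constant_diff[of "\<lambda>t. \<theta> (t + 2 * pi)" \<theta>] cont\<theta> by metis
  then show ?thesis
    using cont\<theta> lift unfolding circle_lift_def by blast
qed

lemma rotation_index_lift_exists:
  assumes "C2_immersed_loop \<alpha>"
  shows "\<exists>\<theta>. circle_lift (unit_tangent \<alpha>) \<theta> (rotation_index \<alpha>)"
proof -
  have nz: "circle_deriv \<alpha> z \<noteq> 0" if "z \<in> S1" for z
    using assms that by (auto simp: C2_immersed_loop_def)
  have "continuous_on UNIV (\<lambda>t. circle_deriv \<alpha> (cis t))"
    using assms unfolding C2_immersed_loop_def C2_on_circle_def
    by (blast intro: C1_differentiable_imp_continuous_on)
  then have "continuous_on UNIV (\<lambda>t. unit_tangent \<alpha> (cis t))"
    unfolding unit_tangent_def by (intro continuous_intros) (auto simp: nz)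
  moreover have "unit_tangent \<alpha> ` S1 \<subseteq> S1"
    using nz by (auto simp: unit_tangent_def)
  ultimately obtain \<theta> n where "circle_lift (unit_tangent \<alpha>) \<theta> n"
    using circle_lift_exists by blast
  then show ?thesis
    unfolding rotation_index_def using circle_degree_eqI by blast
qed

end

theory Submission
  imports Defs
begin

text \<open>
  Suppose the image of \<open>\<alpha>\<close> is invariant under the point reflection \<open>x \<mapsto> 2c - x\<close>.  Adjoin to each
  point of the loop its tangent line, encoded by the square of the unit tangent.  Cleanness says
  precisely that branches through a common point have different tangent lines, so the resulting map
  \<open>\<Gamma>\<close> from the circle is injective, hence a homeomorphism onto its image by compactness.  The
  reflection preserves the directions of lines; it maps the image of \<open>\<Gamma>\<close> to itself because the
  tangent line at a point is the limit of secants, and reflected secants are secants of some branch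
  through the reflected point (\<open>symmetric_point_same_tangent_line\<close>).  Conjugating by \<open>\<Gamma>\<close> gives a
  continuous involution \<open>\<phi>\<close> of the circle with \<open>\<alpha> \<circ> \<phi> = 2c - \<alpha>\<close> that preserves tangent lines
  (\<open>central_symmetry_lift\<close>).

  The rest is a count of angles.  Let \<open>\<theta>\<close> be an angle function of the unit tangent, \<open>n\<close> the rotation
  index, \<open>f\<close> a lift of \<open>\<phi>\<close> to the real line and \<open>d\<close> its degree.  Preservation of tangent lines
  gives \<open>\<theta> (f t) = \<theta> t + \<pi> k\<close> with a constant integer \<open>k\<close>.  Going once around the circle changes the
  two sides by \<open>2\<pi>dn\<close> and \<open>2\<pi>n\<close>, so \<open>n \<noteq> 0\<close> forces \<open>d = 1\<close>: the involution preserves orientation.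
  Then \<open>\<phi>\<close> carries forward secants to forward secants, which the reflection reverses, so the unit
  tangent changes sign under \<open>\<phi>\<close> (\<open>unit_tangent_reversed\<close>) and \<open>k\<close> is odd.  Finally
  \<open>f (f 0) = 2\<pi>m\<close> for some integer \<open>m\<close>, and evaluating \<open>\<theta>\<close> there in both ways gives \<open>k = mn\<close>.
  Hence \<open>n\<close> is odd.
\<close>

section \<open>Loops as functions of the angle\<close>

lemma cis_eq_iff: "cis s = cis t \<longleftrightarrow> (\<exists>k::int. s = t + 2 * pi * of_int k)"
proof -
  have "cis s = cis t \<longleftrightarrow> sin s = sin t \<and> cos s = cos t"
    by (auto simp: complex_eq_iff)
  then show ?thesis
    by (simp add: sin_cos_eq_iff)
qed

lemma S1_cis:
  assumes "z \<in> S1" obtains t where "0 \<le> t" "t \<le> 2 * pi" "z = cis t"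
proof -
  have "z \<noteq> 0" "norm z = 1" using assms by auto
  then have "z = cis (Arg2pi z)"
    using Arg2pi_eq[of z] by (simp add: cis_conv_exp)
  then show thesis
    using that[of "Arg2pi z"] Arg2pi_ge_0[of z] Arg2pi_lt_2pi[of z] by simp
qed

text \<open>Near a point \<open>z = cis t\<close> of the circle, \<open>w \<mapsto> t + Arg (w / z)\<close> is a continuous choice of angle.\<close>

lemma continuous_on_S1I:
  fixes f :: "complex \<Rightarrow> 'a::topological_space"
  assumes cont: "continuous_on UNIV (\<lambda>t. f (cis t))"
  shows "continuous_on S1 f"
  unfolding continuous_on_eq_continuous_within
proof
  fix z assume "z \<in> S1"
  then obtain t where t: "z = cis t" by (rule S1_cis)
  have lim: "((\<lambda>w. t + Arg (w / z)) \<longlongrightarrow> t + Arg (z / z)) (at z within S1)"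
  proof -
    have Arg: "isCont Arg (z / z)" using t by (simp add: continuous_at_Arg)
    have "((\<lambda>w. w / z) \<longlongrightarrow> z / z) (at z within S1)"
      using t by (intro tendsto_intros) simp
    from isCont_tendsto_compose[OF Arg this] show ?thesis
      by (intro tendsto_add tendsto_const)
  qed
  have "isCont (\<lambda>t. f (cis t)) (t + Arg (z / z))"
    using cont by (simp add: continuous_on_eq_continuous_at)
  from isCont_tendsto_compose[OF this lim]
  have "((\<lambda>w. f (cis (t + Arg (w / z)))) \<longlongrightarrow> f z) (at z within S1)"
    by (simp add: t)
  moreover have "\<forall>\<^sub>F w in at z within S1. f (cis (t + Arg (w / z))) = f w"
    unfolding eventually_at_filter
  proof (intro always_eventually allI impI)
    fix w assume "w \<in> S1"
    then have "norm (w / z) = 1" by (simp add: t norm_divide)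
    then have "cis (Arg (w / z)) = w / z"
      by (metis cis_Arg norm_zero sgn_div_norm zero_neq_one inverse_1 scaleR_one)
    then show "f (cis (t + Arg (w / z))) = f w"
      by (simp add: t flip: cis_mult)
  qed
  ultimately show "continuous (at z within S1) f"
    unfolding continuous_within by (rule Lim_transform_eventually)
qed

lemma unit_tangent_eq_sgn: "unit_tangent \<alpha> z = sgn (circle_deriv \<alpha> z)"
  by (simp add: unit_tangent_def sgn_div_norm)

context
  fixes \<alpha> :: "complex \<Rightarrow> complex"
  assumes imm: "C2_immersed_loop \<alpha>"
begin

lemma circle_deriv_nonzero: "circle_deriv \<alpha> (cis t) \<noteq> 0"
  using imm by (auto simp: C2_immersed_loop_def)

lemma loop_has_vector_derivative:
  "((\<lambda>s. \<alpha> (cis s)) has_vector_derivative circle_deriv \<alpha> (cis t)) (at t)"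
proof -
  have "(\<lambda>s. \<alpha> (cis s)) differentiable (at t)"
    using imm unfolding C2_immersed_loop_def C2_on_circle_def C1_differentiable_on_eq by auto
  then show ?thesis
    by (simp add: circle_deriv_cis vector_derivative_works)
qed

lemma continuous_on_loop: "continuous_on UNIV (\<lambda>t. \<alpha> (cis t))"
  by (rule differentiable_imp_continuous_on)
    (auto simp: differentiable_on_def intro!: differentiableI_vector loop_has_vector_derivative)

lemma continuous_on_unit_tangent: "continuous_on UNIV (\<lambda>t. unit_tangent \<alpha> (cis t))"
proof -
  have "continuous_on UNIV (\<lambda>t. circle_deriv \<alpha> (cis t))"
    using imm unfolding C2_immersed_loop_def C2_on_circle_def
    by (blast intro: C1_differentiable_imp_continuous_on)
  then show ?thesis
    unfolding unit_tangent_def by (intro continuous_intros) (auto simp: circle_deriv_nonzero)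
qed

section \<open>Secants\<close>

lemma slope_tendsto:
  "((\<lambda>s. (\<alpha> (cis s) - \<alpha> (cis t)) /\<^sub>R (s - t)) \<longlongrightarrow> circle_deriv \<alpha> (cis t)) (at t)"
proof -
  let ?D = "circle_deriv \<alpha> (cis t)"
  have "((\<lambda>s. norm ((\<alpha> (cis s) - (\<alpha> (cis t) + (s - t) *\<^sub>R ?D)) /\<^sub>R \<bar>s - t\<bar>)) \<longlongrightarrow> 0) (at t)"
    using loop_has_vector_derivative[of t, unfolded has_vector_derivative_def has_derivative_at2]
    by (intro tendsto_norm_zero) (simp add: inverse_eq_divide)
  moreover have "\<forall>\<^sub>F s in at t. norm ((\<alpha> (cis s) - (\<alpha> (cis t) + (s - t) *\<^sub>R ?D)) /\<^sub>R \<bar>s - t\<bar>) =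
      norm ((\<alpha> (cis s) - \<alpha> (cis t)) /\<^sub>R (s - t) - ?D)"
    unfolding eventually_at_filter
  proof (intro always_eventually allI impI)
    fix s assume "s \<noteq> t"
    then have "(\<alpha> (cis s) - \<alpha> (cis t)) /\<^sub>R (s - t) - ?D
        = (\<alpha> (cis s) - (\<alpha> (cis t) + (s - t) *\<^sub>R ?D)) /\<^sub>R (s - t)"
      by (simp add: scaleR_diff_right scaleR_add_right)
    then show "norm ((\<alpha> (cis s) - (\<alpha> (cis t) + (s - t) *\<^sub>R ?D)) /\<^sub>R \<bar>s - t\<bar>) =
      norm ((\<alpha> (cis s) - \<alpha> (cis t)) /\<^sub>R (s - t) - ?D)"
      by simp
  qed
  ultimately have "((\<lambda>s. norm ((\<alpha> (cis s) - \<alpha> (cis t)) /\<^sub>R (s - t) - ?D)) \<longlongrightarrow> 0) (at t)"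
    by (rule Lim_transform_eventually)
  then show ?thesis
    by (simp add: tendsto_norm_zero_iff LIM_zero_iff)
qed

text \<open>
  The factor \<open>sgn (s - t)\<close> orients the secant in the direction of motion.  It drops out for
  parameters \<open>s > t\<close>, and it also drops out when the direction is squared, that is, when the secant
  is regarded as an unoriented line.
\<close>

lemma sgn_slope_tendsto:
  "((\<lambda>s. sgn (s - t) *\<^sub>R sgn (\<alpha> (cis s) - \<alpha> (cis t))) \<longlongrightarrow> unit_tangent \<alpha> (cis t)) (at t)"
  using tendsto_sgn[OF slope_tendsto circle_deriv_nonzero, of t]
  by (simp add: sgn_scaleR unit_tangent_eq_sgn sgn_inverse)

lemma loop_locally_injective: "\<forall>\<^sub>F s in at t. \<alpha> (cis s) \<noteq> \<alpha> (cis t)"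
proof -
  have "\<forall>\<^sub>F s in at t. (\<alpha> (cis s) - \<alpha> (cis t)) /\<^sub>R (s - t) \<noteq> 0"
    by (rule tendsto_imp_eventually_ne[OF slope_tendsto circle_deriv_nonzero])
  then show ?thesis by eventually_elim auto
qed

lemma secant_direction_tendsto:
  "((\<lambda>s. sgn (\<alpha> (cis s) - \<alpha> (cis t))) \<longlongrightarrow> unit_tangent \<alpha> (cis t)) (at_right t)"
proof (rule Lim_transform_eventually)
  show "((\<lambda>s. sgn (s - t) *\<^sub>R sgn (\<alpha> (cis s) - \<alpha> (cis t))) \<longlongrightarrow> unit_tangent \<alpha> (cis t)) (at_right t)"
    using sgn_slope_tendsto by (rule tendsto_within_subset) simp
  show "\<forall>\<^sub>F s in at_right t. sgn (s - t) *\<^sub>R sgn (\<alpha> (cis s) - \<alpha> (cis t)) = sgn (\<alpha> (cis s) - \<alpha> (cis t))"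
    unfolding eventually_at_filter by (intro always_eventually) auto
qed

lemma secant_line_tendsto:
  "((\<lambda>s. (sgn (\<alpha> (cis s) - \<alpha> (cis t)))\<^sup>2) \<longlongrightarrow> (unit_tangent \<alpha> (cis t))\<^sup>2) (at t)"
proof (rule Lim_transform_eventually)
  show "((\<lambda>s. (sgn (s - t) *\<^sub>R sgn (\<alpha> (cis s) - \<alpha> (cis t)))\<^sup>2) \<longlongrightarrow> (unit_tangent \<alpha> (cis t))\<^sup>2) (at t)"
    by (intro tendsto_intros sgn_slope_tendsto)
  show "\<forall>\<^sub>F s in at t. (sgn (s - t) *\<^sub>R sgn (\<alpha> (cis s) - \<alpha> (cis t)))\<^sup>2 = (sgn (\<alpha> (cis s) - \<alpha> (cis t)))\<^sup>2"
    unfolding eventually_at_filter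
    by (intro always_eventually) (auto simp: sgn_real_def power2_eq_square)
qed


section \<open>The central symmetry lifts to an involution of the circle\<close>

text \<open>
  Approach \<open>t\<close> by other parameters and choose a parameter for each reflected point.  The chosen
  parameters subconverge to some \<open>r\<close>, which picks out the branch through the reflected point.
  Secants of the loop at \<open>t\<close> are then opposite to secants at \<open>r\<close>, so their limit lines agree.
\<close>

lemma symmetric_point_same_tangent_line:
  assumes sym: "(\<lambda>x. 2 * c - x) ` (\<alpha> ` S1) = \<alpha> ` S1"
  obtains r where "\<alpha> (cis r) = 2 * c - \<alpha> (cis t)"
    "(unit_tangent \<alpha> (cis r))\<^sup>2 = (unit_tangent \<alpha> (cis t))\<^sup>2"
proof -
  have "\<exists>r\<in>{0..2 * pi}. \<alpha> (cis r) = 2 * c - \<alpha> (cis s)" for s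
  proof -
    have "2 * c - \<alpha> (cis s) \<in> \<alpha> ` S1"
      using sym by force
    then show ?thesis
      by (metis S1_cis atLeastAtMost_iff imageE)
  qed
  then obtain g where g: "\<And>s. g s \<in> {0..2 * pi}" "\<And>s. \<alpha> (cis (g s)) = 2 * c - \<alpha> (cis s)"
    by metis
  define u where "u n = t + 1 / real (Suc n)" for n
  have "(\<lambda>n. t + 1 / real (Suc n)) \<longlonglongrightarrow> t + 0"
    by (intro tendsto_intros LIMSEQ_Suc lim_const_over_n)
  then have u: "u \<longlonglongrightarrow> t" by (simp add: u_def[abs_def])
  obtain r h where h: "strict_mono h" and r: "((\<lambda>n. g (u n)) \<circ> h) \<longlonglongrightarrow> r"
    using compact_Icc[of 0 "2 * pi"] g(1) unfolding compact_def by metis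
  define v w where "v n = u (h n)" and "w n = g (v n)" for n
  have v: "filterlim v (at t) sequentially"
    unfolding filterlim_at
    using LIMSEQ_subseq_LIMSEQ[OF u h] by (auto simp: v_def[abs_def] o_def u_def)
  have wr: "w \<longlonglongrightarrow> r"
    using r by (simp add: w_def[abs_def] v_def o_def)
  have lim: "(\<lambda>n. \<alpha> (cis (f n))) \<longlonglongrightarrow> \<alpha> (cis x)" if "f \<longlonglongrightarrow> x" for f x
    using continuous_on_tendsto_compose[OF continuous_on_loop that] by simp
  have "(\<lambda>n. 2 * c - \<alpha> (cis (v n))) \<longlonglongrightarrow> 2 * c - \<alpha> (cis t)"
    using v by (intro tendsto_intros lim) (simp add: filterlim_at)
  then have "(\<lambda>n. \<alpha> (cis (w n))) \<longlonglongrightarrow> 2 * c - \<alpha> (cis t)"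
    by (simp add: w_def g(2))
  then have ar: "\<alpha> (cis r) = 2 * c - \<alpha> (cis t)"
    using lim[OF wr] LIMSEQ_unique by blast
  have secant: "\<alpha> (cis (w n)) - \<alpha> (cis r) = - (\<alpha> (cis (v n)) - \<alpha> (cis t))" for n
    by (simp add: ar w_def g(2))
  \<comment> \<open>The secants at \<open>r\<close> must not degenerate: \<open>w n = r\<close> would make the secant at \<open>t\<close> vanish.\<close>
  have "\<forall>\<^sub>F n in sequentially. \<alpha> (cis (v n)) \<noteq> \<alpha> (cis t)"
    using loop_locally_injective v by (rule eventually_compose_filterlim)
  then have "\<forall>\<^sub>F n in sequentially. w n \<noteq> r"
    by eventually_elim (metis secant diff_self eq_iff_diff_eq_0 neg_equal_0_iff_equal)
  then have w: "filterlim w (at r) sequentially"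
    using wr by (simp add: filterlim_at)
  have "(\<lambda>n. (sgn (\<alpha> (cis (w n)) - \<alpha> (cis r)))\<^sup>2) \<longlonglongrightarrow> (unit_tangent \<alpha> (cis r))\<^sup>2"
    by (rule filterlim_compose[OF secant_line_tendsto w])
  moreover have "(\<lambda>n. (sgn (\<alpha> (cis (v n)) - \<alpha> (cis t)))\<^sup>2) \<longlonglongrightarrow> (unit_tangent \<alpha> (cis t))\<^sup>2"
    by (rule filterlim_compose[OF secant_line_tendsto v])
  ultimately have "(unit_tangent \<alpha> (cis r))\<^sup>2 = (unit_tangent \<alpha> (cis t))\<^sup>2"
    unfolding secant sgn_minus by (simp add: LIMSEQ_unique)
  then show thesis using ar that by blast
qed

text \<open>
  The square of a unit vector determines the vector up to sign, so the second component
  represents the tangent line as a point of the projective line, which is again a circle.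
\<close>

definition tangent_line_lift :: "complex \<Rightarrow> complex \<times> complex" where
  "tangent_line_lift z = (\<alpha> z, (unit_tangent \<alpha> z)\<^sup>2)"

lemma continuous_on_tangent_line_lift: "continuous_on S1 tangent_line_lift"
  unfolding tangent_line_lift_def
  by (intro continuous_on_Pair continuous_on_power continuous_on_S1I
      continuous_on_loop continuous_on_unit_tangent)

text \<open>
  Two branches that share a point and a tangent line have parallel velocities, and these cannot
  span the plane.
\<close>

lemma inj_on_tangent_line_lift:
  assumes "clean \<alpha>"
  shows "inj_on tangent_line_lift S1"
proof (rule inj_onI, rule ccontr)
  fix z w assume zw: "z \<in> S1" "w \<in> S1" "tangent_line_lift z = tangent_line_lift w" "z \<noteq> w"
  let ?D = "circle_deriv \<alpha>"
  have "span {?D z, ?D w} = UNIV"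
    using assms zw unfolding clean_def transversal_images_def tangent_line_lift_def by blast
  moreover have "?D z \<in> span {?D w}"
  proof -
    have "unit_tangent \<alpha> z = unit_tangent \<alpha> w \<or> unit_tangent \<alpha> z = - unit_tangent \<alpha> w"
      using zw(3) by (simp add: tangent_line_lift_def power2_eq_iff)
    then have "unit_tangent \<alpha> z \<in> span {?D w}"
      by (metis unit_tangent_def span_neg span_mul span_base singletonI)
    moreover have "?D z = norm (?D z) *\<^sub>R unit_tangent \<alpha> z"
      by (cases "?D z = 0") (simp_all add: unit_tangent_def)
    ultimately show ?thesis
      by (metis span_mul)
  qed
  ultimately have "(UNIV :: complex set) \<subseteq> span {?D w}"
    by (simp add: span_redundant)
  then have "dim (UNIV :: complex set) \<le> card {?D w}"
    by (rule real_vector.dim_le_card) simp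
  then show False by simp
qed

text \<open>
  With \<open>\<Gamma>\<close> a homeomorphism onto its image and \<open>\<sigma>\<close> the reflection acting on pairs of a point and a
  line direction, the required map is \<open>inv \<Gamma> \<circ> \<sigma> \<circ> \<Gamma>\<close>; it is an involution because \<open>\<sigma>\<close> is one.
\<close>

lemma central_symmetry_lift:
  assumes "clean \<alpha>" and sym: "(\<lambda>x. 2 * c - x) ` (\<alpha> ` S1) = \<alpha> ` S1"
  obtains \<phi> where "continuous_on S1 \<phi>" "\<phi> ` S1 \<subseteq> S1" "\<And>z. z \<in> S1 \<Longrightarrow> \<phi> (\<phi> z) = z"
    "\<And>z. z \<in> S1 \<Longrightarrow> \<alpha> (\<phi> z) = 2 * c - \<alpha> z"
    "\<And>z. z \<in> S1 \<Longrightarrow> (unit_tangent \<alpha> (\<phi> z))\<^sup>2 = (unit_tangent \<alpha> z)\<^sup>2"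
proof -
  let ?\<Gamma> = tangent_line_lift
  define \<sigma> :: "complex \<times> complex \<Rightarrow> complex \<times> complex" where "\<sigma> = (\<lambda>(x, l). (2 * c - x, l))"
  define \<phi> where "\<phi> z = the_inv_into S1 ?\<Gamma> (\<sigma> (?\<Gamma> z))" for z
  note inj = inj_on_tangent_line_lift[OF assms(1)]
  have img: "\<sigma> (?\<Gamma> z) \<in> ?\<Gamma> ` S1" if "z \<in> S1" for z
  proof -
    obtain t where t: "z = cis t" using \<open>z \<in> S1\<close> by (rule S1_cis)
    obtain r where "?\<Gamma> (cis r) = \<sigma> (?\<Gamma> z)"
      using symmetric_point_same_tangent_line[OF sym, of t]
      by (auto simp: t \<sigma>_def tangent_line_lift_def)
    then show ?thesis
      by (metis image_eqI mem_sphere_0 norm_cis)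
  qed
  have S1: "\<phi> z \<in> S1" if "z \<in> S1" for z
    unfolding \<phi>_def by (rule the_inv_into_into[OF inj img[OF that] subset_refl])
  have \<Gamma>: "?\<Gamma> (\<phi> z) = \<sigma> (?\<Gamma> z)" if "z \<in> S1" for z
    unfolding \<phi>_def by (rule f_the_inv_into_f[OF inj img[OF that]])
  show thesis
  proof
    have "continuous_on (?\<Gamma> ` S1) \<sigma>"
      unfolding \<sigma>_def split_beta by (intro continuous_intros)
    then have "continuous_on S1 (\<lambda>z. \<sigma> (?\<Gamma> z))"
      by (rule continuous_on_compose2[OF _ continuous_on_tangent_line_lift]) simp
    then show "continuous_on S1 \<phi>"
      unfolding \<phi>_def
      by (rule continuous_on_compose2[OF
            continuous_on_inv_into[OF continuous_on_tangent_line_lift compact_sphere inj]])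
        (use img in blast)
    show "\<phi> ` S1 \<subseteq> S1" using S1 by blast
    fix z assume z: "z \<in> S1"
    have "?\<Gamma> (\<phi> (\<phi> z)) = ?\<Gamma> z"
      using \<Gamma>[OF S1[OF z]] \<Gamma>[OF z] by (simp add: \<sigma>_def split_beta)
    then show "\<phi> (\<phi> z) = z"
      using inj_onD[OF inj _ S1[OF S1[OF z]] z] by blast
    show "\<alpha> (\<phi> z) = 2 * c - \<alpha> z" "(unit_tangent \<alpha> (\<phi> z))\<^sup>2 = (unit_tangent \<alpha> z)\<^sup>2"
      using \<Gamma>[OF z] by (auto simp: \<sigma>_def tangent_line_lift_def)
  qed
qed


section \<open>An orientation preserving symmetry turns the tangent by a half turn\<close>

text \<open>
  As \<open>s\<close> decreases to \<open>0\<close>, so does \<open>f s\<close> to \<open>f 0\<close>.  The forward secants at \<open>f 0\<close> are the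
  negatives of the forward secants at \<open>0\<close>, and both families converge to unit tangents.
\<close>

lemma unit_tangent_reversed:
  assumes f: "continuous_on UNIV f" and incr: "\<And>s. 0 < s \<Longrightarrow> s < 2 * pi \<Longrightarrow> f 0 < f s"
    and sym: "\<And>s. \<alpha> (cis (f s)) = 2 * c - \<alpha> (cis s)"
  shows "unit_tangent \<alpha> (cis (f 0)) = - unit_tangent \<alpha> (cis 0)"
proof -
  have "(f \<longlongrightarrow> f 0) (at_right 0)"
    using f by (auto simp: continuous_on_def intro: tendsto_within_subset)
  moreover have "\<forall>\<^sub>F s in at_right 0. f s \<in> {f 0<..} \<and> f s \<noteq> f 0"
    unfolding eventually_at_right_field using incr by (intro exI[of _ "2 * pi"]) fastforce
  ultimately have "filterlim f (at_right (f 0)) (at_right 0)"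
    by (simp add: filterlim_at)
  from filterlim_compose[OF secant_direction_tendsto this]
  have "((\<lambda>s. - sgn (\<alpha> (cis s) - \<alpha> (cis 0))) \<longlongrightarrow> unit_tangent \<alpha> (cis (f 0))) (at_right 0)"
    by (simp add: sym flip: sgn_minus)
  moreover have "((\<lambda>s. - sgn (\<alpha> (cis s) - \<alpha> (cis 0))) \<longlongrightarrow> - unit_tangent \<alpha> (cis 0)) (at_right 0)"
    by (intro tendsto_minus secant_direction_tendsto)
  ultimately show ?thesis
    by (intro tendsto_unique[OF trivial_limit_at_right_real])
qed

end

lemma circle_lift_shift:
  assumes "circle_lift g f n"
  shows "f (t + 2 * pi * of_int j) = f t + 2 * pi * of_int j * of_int n"
proof -
  have period: "f (s + 2 * pi) = f s + 2 * pi * of_int n" for s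
    using assms by (simp add: circle_lift_def)
  show ?thesis
  proof (induction j rule: int_induct[of _ 0])
    case (step1 i)
    then show ?case using period[of "t + 2 * pi * of_int i"] by (simp add: algebra_simps)
  next
    case (step2 i)
    then show ?case using period[of "t + 2 * pi * of_int (i - 1)"] by (simp add: algebra_simps)
  qed simp
qed

text \<open>
  The lift is injective on the line, so \<open>f s\<close> lies strictly between \<open>f 0\<close> and
  \<open>f (2 * pi) = f 0 + 2 * pi\<close>.
\<close>

lemma lift_of_injective_degree_one_increasing:
  assumes lift: "circle_lift \<phi> f 1" and inj: "inj_on \<phi> S1" and s: "0 < s" "s < 2 * pi"
  shows "f 0 < f s"
proof -
  have f: "continuous_on UNIV f" "\<And>t. \<phi> (cis t) = cis (f t)"
    using lift by (auto simp: circle_lift_def)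
  have "inj f"
  proof (rule injI)
    fix x y assume eq: "f x = f y"
    then have "cis x = cis y"
      using inj f(2) by (metis inj_onD mem_sphere_0 norm_cis)
    then obtain k :: int where "x = y + 2 * pi * of_int k"
      by (auto simp: cis_eq_iff)
    then show "x = y" using eq circle_lift_shift[OF lift, of y k] by simp
  qed
  have "f (2 * pi) = f 0 + 2 * pi"
    using circle_lift_shift[OF lift, of 0 1] by simp
  then have "f 0 < f (2 * pi)"
    by simp
  moreover have "f 0 < f s \<and> f s < f (2 * pi) \<or> f (2 * pi) < f s \<and> f s < f 0"
    using s continuous_on_subset[OF f(1) subset_UNIV] inj_on_subset[OF \<open>inj f\<close> subset_UNIV]
    by (rule continuous_inj_imp_mono)
  ultimately show ?thesis
    by linarith
qed


section \<open>The parity of the rotation index\<close>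

theorem corollary2p17:
  fixes \<alpha> :: "complex \<Rightarrow> complex"
  assumes "C2_immersed_loop \<alpha>"
    and "clean \<alpha>"
    and "even (rotation_index \<alpha>)"
    and "rotation_index \<alpha> \<noteq> 0"
  shows "\<not> centrally_symmetric \<alpha>"
proof
  assume "centrally_symmetric \<alpha>"
  then obtain c where sym: "(\<lambda>x. 2 * c - x) ` (\<alpha> ` S1) = \<alpha> ` S1"
    by (auto simp: centrally_symmetric_def)
  let ?T = "unit_tangent \<alpha>" and ?n = "rotation_index \<alpha>"
  obtain \<phi> where \<phi>: "continuous_on S1 \<phi>" "\<phi> ` S1 \<subseteq> S1"
    and invol: "\<And>z. z \<in> S1 \<Longrightarrow> \<phi> (\<phi> z) = z"
    and \<phi>_sym: "\<And>z. z \<in> S1 \<Longrightarrow> \<alpha> (\<phi> z) = 2 * c - \<alpha> z"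
    and \<phi>_line: "\<And>z. z \<in> S1 \<Longrightarrow> (?T (\<phi> z))\<^sup>2 = (?T z)\<^sup>2"
    using central_symmetry_lift[OF assms(1,2) sym] by metis
  have cis_S1: "cis t \<in> S1" for t by simp
  have "continuous_on UNIV (\<lambda>t. \<phi> (cis t))"
    by (rule continuous_on_compose2[OF \<phi>(1)]) (auto intro: continuous_intros)
  then obtain f d where lift: "circle_lift \<phi> f d"
    using circle_lift_exists \<phi>(2) by blast
  then have f: "continuous_on UNIV f" "\<And>t. \<phi> (cis t) = cis (f t)"
    by (auto simp: circle_lift_def)
  obtain \<theta> where \<theta>_lift: "circle_lift ?T \<theta> ?n"
    using rotation_index_lift_exists[OF assms(1)] by blast
  then have \<theta>: "continuous_on UNIV \<theta>" "\<And>t. ?T (cis t) = cis (\<theta> t)"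
    by (auto simp: circle_lift_def)
  \<comment> \<open>Squares of unit tangents have twice the angle, so equality of lines is equality of doubled angles.\<close>
  obtain k :: int where k2: "\<And>t. 2 * \<theta> (f t) = 2 * \<theta> t + 2 * pi * of_int k"
  proof (rule cis_eq_constant_diff[of "\<lambda>t. 2 * \<theta> (f t)" "\<lambda>t. 2 * \<theta> t"])
    have "continuous_on UNIV (\<lambda>t. \<theta> (f t))"
      by (rule continuous_on_compose2[OF \<theta>(1) f(1)]) simp
    then show "continuous_on UNIV (\<lambda>t. 2 * \<theta> (f t))" by (intro continuous_intros)
    show "continuous_on UNIV (\<lambda>t. 2 * \<theta> t)" by (intro continuous_intros \<theta>(1))
    show "cis (2 * \<theta> (f t)) = cis (2 * \<theta> t)" for t
      using \<phi>_line[OF cis_S1, of t] by (simp add: f(2) \<theta>(2) Complex.DeMoivre)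
  qed blast
  have k: "\<theta> (f t) = \<theta> t + pi * of_int k" for t
    using k2[of t] by simp

  \<comment> \<open>Compare the increments of the two sides of the last equation over one period.\<close>
  have "2 * pi * (of_int d * of_int ?n) = 2 * pi * (of_int ?n :: real)"
    using k[of "0 + 2 * pi"] k[of 0] circle_lift_shift[OF \<theta>_lift, of 0 1]
      circle_lift_shift[OF \<theta>_lift, of "f 0" d] circle_lift_shift[OF lift, of 0 1]
    by (simp add: algebra_simps)
  then have "real_of_int d = 1"
    using assms(4) by simp
  then have "d = 1" by simp

  have "inj_on \<phi> S1"
    using invol by (rule inj_on_inverseI)
  then have "?T (cis (f 0)) = - ?T (cis 0)"
    using lift \<open>d = 1\<close> lift_of_injective_degree_one_increasing \<phi>_sym[OF cis_S1]
    by (intro unit_tangent_reversed[OF assms(1) f(1)]) (auto simp: f(2))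
  then have "cis (\<theta> 0) * cis (pi * of_int k) = cis (\<theta> 0) * (- 1)"
    by (simp only: \<theta>(2) k cis_mult[symmetric] mult_minus_right mult_1_right)
  then have half_turn: "cis (pi * of_int k) = - 1"
    using mult_left_cancel[OF cis_neq_zero] by blast
  have "odd k"
  proof
    assume "even k"
    then obtain j where "k = 2 * j" by (rule evenE)
    then have "cis (pi * of_int k) = cis 0"
      unfolding cis_eq_iff by (intro exI[of _ j]) simp
    with half_turn show False by simp
  qed

  \<comment> \<open>Two applications of \<open>f\<close> add \<open>2 * pi * k\<close> to the tangent angle, and they amount to \<open>m\<close> full turns.\<close>
  have "cis (f (f 0)) = cis 0"
    using invol[OF cis_S1, of 0] by (metis f(2))
  then obtain m :: int where m: "f (f 0) = 0 + 2 * pi * of_int m"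
    unfolding cis_eq_iff by blast
  have "2 * pi * (of_int m * of_int ?n) = 2 * pi * (of_int k :: real)"
    using k[of "f 0"] k[of 0] circle_lift_shift[OF \<theta>_lift, of 0 m] unfolding m by (simp add: algebra_simps)
  then have "real_of_int (m * ?n) = real_of_int k" by simp
  then have "k = m * ?n" by linarith
  with \<open>odd k\<close> assms(3) show False by simp
qed

end
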